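(* Let $K$ be a field and $X$ a finite non-empty set. For a rational series $S\in K\langle\!\langle X\rangle\!\rangle$, the following statements are equivalent. (a) $S$ is recognized by a deterministic weighted automaton (with weights in $K$). (b) If $(u,\mu,v)$ is a minimal linear representation of $S$, then its linear hull has dimension at most $1$.
   Context: $X^*$ is the free monoid on $X$. $K\langle\!\langle X\rangle\!\rangle$ is the ring of noncommutative formal power series $S=\sum_{w\in X^*}S(w)w$. Rational series form the smallest subring of $K\langle\!\langle X\rangle\!\rangle$ containing the noncommutative polynomials and closed under $S\mapsto S^*=\sum_{n\ge0}S^n$ for $S$ with zero constant coefficient. A linear representation of rank (dimension) $n$ of $S$ is a triple $(u,\mu,v)$ with $u\in K^{1\times n}$, $v\in K^{n\times1}$ and $\mu\colon X^*\to K^{n\times n}$ a monoid homomorphism (to the multiplicative monoid of matrices) such that $S(w)=u\mu(w)v$ for all $w\in X^*$. (A series is rational if and only if it has a linear representation.) It is minimal if $n$ is minimal among all linear representations of $S$. Linear Zariski topology: on a finite-dimensional $K$-vector space $V$, the closed sets are exactly the finite (possibly empty) unions of vector subspaces of $V$; this is a noetherian topology. The dimension of a closed set is the maximal dimension of its irreducible components (which are vector subspaces), with $\dim\emptyset=-\infty$. The (left) linear hull of $(u,\mu,v)$ is the closure $\overline{\Omega}$ of $\Omega=\{u\mu(w):w\in X^*\}$ in $K^{1\times n}$ in the linear Zariski topology. A weighted (finite) automaton $\mathcal{A}=(Q,I,E,T)$ over $X$ with weights in $K$ consists of a finite set $Q$ of states and maps $I\colon Q\to K$, $E\colon Q\times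 X\times Q\to K$, $T\colon Q\to K$. A state $p$ is initial if $I(p)\neq0$. $\mathcal{A}$ recognizes $S$ if for all $w=x_1\cdots x_l$ ($x_i\in X$), $S(w)=\sum_{p_0,\ldots,p_l\in Q}I(p_0)E(p_0,x_1,p_1)\cdots E(p_{l-1},x_l,p_l)T(p_l)$. $\mathcal{A}$ is deterministic if there is at most one initial state and, for each $(p,x)\in Q\times X$, there is at most one $q\in Q$ with $E(p,x,q)\ne0$. *)

theory Defs
  imports "Jordan_Normal_Form.VS_Connect" "HOL-Analysis.Abstract_Topology"
    "HOL-Library.Extended_Real"
begin

section \<open>Rational series\<close>

text \<open>A series over the alphabet \<open>'x\<close> is its coefficient function on the free monoid
  \<open>'x list\<close>.\<close>

type_synonym ('x, 'k) series = "'x list \<Rightarrow> 'k"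

definition series_one :: "('x, 'k::field) series" where
  "series_one w = (if w = [] then 1 else 0)"

definition series_mult :: "('x, 'k::field) series \<Rightarrow> ('x, 'k) series \<Rightarrow> ('x, 'k) series" where
  "series_mult S T w = (\<Sum>i\<le>length w. S (take i w) * T (drop i w))"

primrec series_power :: "('x, 'k::field) series \<Rightarrow> nat \<Rightarrow> ('x, 'k) series" where
  "series_power S 0 = series_one"
| "series_power S (Suc n) = series_mult S (series_power S n)"

text \<open>If the constant coefficient of \<open>S\<close> vanishes, then the coefficient of \<open>w\<close> in the \<open>n\<close>-th
  power of \<open>S\<close> is zero for \<open>n > length w\<close>, so the infinite sum over all powers of \<open>S\<close> is a finite
  sum in each coefficient.\<close>

definition series_star :: "('x, 'k::field) series \<Rightarrow> ('x, 'k) series" where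
  "series_star S w = (\<Sum>n | series_power S n w \<noteq> 0. series_power S n w)"

lemma series_power_eq_0:
  assumes "S [] = 0" "length w < n"
  shows "series_power S n w = 0"
  using assms(2)
proof (induction n arbitrary: w)
  case (Suc n)
  have "S (take i w) * series_power S n (drop i w) = 0" if "i \<le> length w" for i
    using that Suc assms(1) by (cases "i = 0") (auto intro!: Suc.IH)
  then show ?case by (auto simp only: series_power.simps series_mult_def atMost_iff intro!: sum.neutral)
qed simp

lemma series_star_finite: "S [] = 0 \<Longrightarrow> finite {n. series_power S n w \<noteq> 0}"
  by (rule finite_subset[of _ "{..length w}"]) (auto simp: not_less[symmetric] series_power_eq_0)

inductive rational_series :: "('x, 'k::field) series \<Rightarrow> bool" where
  polynomial: "finite {w. P w \<noteq> 0} \<Longrightarrow> rational_series P"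
| add: "rational_series S \<Longrightarrow> rational_series T \<Longrightarrow> rational_series (\<lambda>w. S w + T w)"
| uminus: "rational_series S \<Longrightarrow> rational_series (\<lambda>w. - S w)"
| mult: "rational_series S \<Longrightarrow> rational_series T \<Longrightarrow> rational_series (series_mult S T)"
| star: "rational_series S \<Longrightarrow> S [] = 0 \<Longrightarrow> rational_series (series_star S)"


section \<open>Linear representations\<close>

text \<open>Both the row vectors in \<open>K\<^sup>1\<^sup>\<times>\<^sup>n\<close> and the column vectors in \<open>K\<^sup>n\<^sup>\<times>\<^sup>1\<close> are elements of
  \<^term>\<open>carrier_vec n\<close>; the product of a row vector and a matrix is the following counterpart of
  \<^const>\<open>mult_mat_vec\<close>.\<close>

definition mult_vec_mat :: "'k::field vec \<Rightarrow> 'k mat \<Rightarrow> 'k vec" where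
  "mult_vec_mat u M = vec (dim_col M) (\<lambda>j. u \<bullet> col M j)"

definition free_monoid_rep :: "nat \<Rightarrow> ('x list \<Rightarrow> 'k::field mat) \<Rightarrow> bool" where
  "free_monoid_rep n \<mu> \<longleftrightarrow>
     (\<forall>w. \<mu> w \<in> carrier_mat n n) \<and> \<mu> [] = 1\<^sub>m n \<and> (\<forall>w w'. \<mu> (w @ w') = \<mu> w * \<mu> w')"

definition linear_representation ::
    "('x, 'k::field) series \<Rightarrow> nat \<Rightarrow> 'k vec \<Rightarrow> ('x list \<Rightarrow> 'k mat) \<Rightarrow> 'k vec \<Rightarrow> bool" where
  "linear_representation S n u \<mu> v \<longleftrightarrow>
     u \<in> carrier_vec n \<and> v \<in> carrier_vec n \<and> free_monoid_rep n \<mu> \<and>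
     (\<forall>w. S w = mult_vec_mat u (\<mu> w) \<bullet> v)"

definition minimal_linear_representation ::
    "('x, 'k::field) series \<Rightarrow> nat \<Rightarrow> 'k vec \<Rightarrow> ('x list \<Rightarrow> 'k mat) \<Rightarrow> 'k vec \<Rightarrow> bool" where
  "minimal_linear_representation S n u \<mu> v \<longleftrightarrow>
     linear_representation S n u \<mu> v \<and>
     (\<forall>n' u' \<mu>' v'. linear_representation S n' u' \<mu>' v' \<longrightarrow> n \<le> n')"


section \<open>The linear Zariski topology\<close>

definition linear_closed :: "('k, 'r) ring_scheme \<Rightarrow> ('k, 'v, 'm) module_scheme \<Rightarrow> 'v set \<Rightarrow> bool"
  where "linear_closed K V C \<longleftrightarrow> (\<exists>F. finite F \<and> (\<forall>W\<in>F. VectorSpace.subspace K W V) \<and> C = \<Union>F)"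

definition linear_zariski :: "('k, 'r) ring_scheme \<Rightarrow> ('k, 'v, 'm) module_scheme \<Rightarrow> 'v topology"
  where "linear_zariski K V = topology (\<lambda>U. U \<subseteq> carrier V \<and> linear_closed K V (carrier V - U))"

definition irreducible_in :: "'a topology \<Rightarrow> 'a set \<Rightarrow> bool" where
  "irreducible_in T A \<longleftrightarrow> A \<subseteq> topspace T \<and> A \<noteq> {} \<and>
     (\<forall>C D. closedin T C \<longrightarrow> closedin T D \<longrightarrow> A \<subseteq> C \<union> D \<longrightarrow> A \<subseteq> C \<or> A \<subseteq> D)"

definition irreducible_components_of :: "'a topology \<Rightarrow> 'a set \<Rightarrow> 'a set set" where
  "irreducible_components_of T A =
     {B. B \<subseteq> A \<and> irreducible_in T B \<and>
         (\<forall>B'. irreducible_in T B' \<longrightarrow> B \<subseteq> B' \<longrightarrow> B' \<subseteq> A \<longrightarrow> B' = B)}"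

text \<open>The irreducible components of a closed set are subspaces (see below), so that their
  dimension makes sense. In \<^typ>\<open>ereal\<close> the supremum over the empty set is \<open>-\<infinity>\<close>.\<close>

definition linear_zariski_dim ::
    "('k, 'r) ring_scheme \<Rightarrow> ('k, 'v, 'm) module_scheme \<Rightarrow> 'v set \<Rightarrow> ereal" where
  "linear_zariski_dim K V C =
     (SUP W \<in> irreducible_components_of (linear_zariski K V) C.
        ereal (real (vectorspace.dim K (V\<lparr>carrier := W\<rparr>))))"

text \<open>Outside of finite-dimensional spaces \<^const>\<open>linear_zariski\<close> need not be meaningful, since there
  the finite unions of subspaces are not closed under arbitrary intersections. In the
  finite-dimensional case they are the closed sets of a topology.\<close>

context vectorspace
begin

lemma subspace_Int:
  "VectorSpace.subspace K U V \<Longrightarrow> VectorSpace.subspace K W V \<Longrightarrow> VectorSpace.subspace K (U \<inter> W) V"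
  unfolding VectorSpace.subspace_def submodule_def by auto

lemma subspace_carrier: "VectorSpace.subspace K (carrier V) V"
  unfolding VectorSpace.subspace_def submodule_def
  by (auto intro: vectorspace_axioms module_axioms)

lemma card_li_proper_subspace:
  assumes fd: fin_dim
    and W: "VectorSpace.subspace K W V" and U: "VectorSpace.subspace K U V" and "U \<subset> W"
    and k: "\<And>A. A \<subseteq> W \<Longrightarrow> lin_indpt A \<Longrightarrow> card A \<le> k"
    and A: "A \<subseteq> U" "lin_indpt A"
  shows "Suc (card A) \<le> k"
proof -
  obtain x where x: "x \<in> W" "x \<notin> U" using \<open>U \<subset> W\<close> by blast
  have carr: "W \<subseteq> carrier V" "U \<subseteq> carrier V"
    using W U unfolding VectorSpace.subspace_def submodule_def by auto
  have "span A \<subseteq> U"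
    using A(1) U by (intro span_is_subset) auto
  then have "x \<notin> span A" using x by blast
  then have "lin_indpt (insert x A)"
    using lin_dep_iff_in_span[of A x] A x carr span_mem[of A x] by auto
  then have "card (insert x A) \<le> k" using k A(1) x \<open>U \<subset> W\<close> by auto
  moreover have "finite A" using fin_dim_li_fin[OF fd A(2)] A(1) carr by auto
  ultimately show ?thesis using A(1) x by (auto simp: card_insert_if split: if_splits)
qed

lemma linear_closed_Inter_aux:
  assumes fd: fin_dim and CC: "\<And>C. C \<in> CC \<Longrightarrow> linear_closed K V C"
  shows "VectorSpace.subspace K W V \<Longrightarrow> (\<And>A. A \<subseteq> W \<Longrightarrow> lin_indpt A \<Longrightarrow> card A \<le> k) \<Longrightarrow>
    linear_closed K V (W \<inter> \<Inter>CC)"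
proof (induction k arbitrary: W rule: less_induct)
  case (less k)
  show ?case
  proof (cases "W \<subseteq> \<Inter>CC")
    case True
    then have "W \<inter> \<Inter>CC = \<Union>{W}" by auto
    then show ?thesis unfolding linear_closed_def using less.prems(1)
      by (intro exI[of _ "{W}"]) auto
  next
    case False
    then obtain C where C: "C \<in> CC" "\<not> W \<subseteq> C" by auto
    obtain G where G: "finite G" "\<And>U. U \<in> G \<Longrightarrow> VectorSpace.subspace K U V" "C = \<Union>G"
      using CC[OF C(1)] unfolding linear_closed_def by auto
    have "linear_closed K V ((W \<inter> U) \<inter> \<Inter>CC)" if "U \<in> G" for U
    proof (rule less.IH)
      show sub: "VectorSpace.subspace K (W \<inter> U) V" using less.prems(1) G(2)[OF that] by (rule subspace_Int)
      have "W \<inter> U \<subset> W" using C(2) G(3) that by auto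
      then have *: "Suc (card A) \<le> k" if "A \<subseteq> W \<inter> U" "lin_indpt A" for A
        using card_li_proper_subspace[OF fd less.prems(1) sub _ less.prems(2) that] by auto
      have "lin_indpt {}" unfolding lin_dep_def by auto
      from *[OF _ this] show "k - 1 < k" by auto
      show "card A \<le> k - 1" if "A \<subseteq> W \<inter> U" "lin_indpt A" for A
        using *[OF that] by auto
    qed
    then have "\<forall>U\<in>G. \<exists>F. finite F \<and> (\<forall>W\<in>F. VectorSpace.subspace K W V) \<and> (W \<inter> U) \<inter> \<Inter>CC = \<Union>F"
      unfolding linear_closed_def by auto
    then obtain F where F: "\<And>U. U \<in> G \<Longrightarrow> finite (F U)"
      "\<And>U W'. U \<in> G \<Longrightarrow> W' \<in> F U \<Longrightarrow> VectorSpace.subspace K W' V"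
      "\<And>U. U \<in> G \<Longrightarrow> (W \<inter> U) \<inter> \<Inter>CC = \<Union>(F U)" by metis
    have "W \<inter> \<Inter>CC = (\<Union>U\<in>G. (W \<inter> U) \<inter> \<Inter>CC)" using C(1) G(3) by auto
    also have "\<dots> = (\<Union>U\<in>G. \<Union>(F U))" using F(3) by (intro SUP_cong) auto
    also have "\<dots> = \<Union>(\<Union>U\<in>G. F U)" by auto
    finally show ?thesis unfolding linear_closed_def
      using F(1,2) G(1) by (intro exI[of _ "\<Union>U\<in>G. F U"]) auto
  qed
qed

lemma linear_closed_Inter:
  assumes fin_dim and "\<And>C. C \<in> CC \<Longrightarrow> linear_closed K V C"
  shows "linear_closed K V (carrier V \<inter> \<Inter>CC)"
  by (rule linear_closed_Inter_aux[OF assms subspace_carrier]) (auto intro: li_le_dim(2)[OF assms(1)])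

lemma linear_closed_Un:
  assumes "linear_closed K V C" "linear_closed K V D"
  shows "linear_closed K V (C \<union> D)"
proof -
  obtain F G where "finite F" "\<forall>W\<in>F. VectorSpace.subspace K W V" "C = \<Union>F"
    "finite G" "\<forall>W\<in>G. VectorSpace.subspace K W V" "D = \<Union>G"
    using assms unfolding linear_closed_def by auto
  then show ?thesis unfolding linear_closed_def by (intro exI[of _ "F \<union> G"]) auto
qed

lemma linear_closed_subset: "linear_closed K V C \<Longrightarrow> C \<subseteq> carrier V"
  unfolding linear_closed_def VectorSpace.subspace_def submodule_def by auto

lemma istopology_linear_zariski:
  assumes fin_dim
  shows "istopology (\<lambda>U. U \<subseteq> carrier V \<and> linear_closed K V (carrier V - U))"
  unfolding istopology_def
proof (intro conjI allI impI)
  fix S T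
  assume "S \<subseteq> carrier V \<and> linear_closed K V (carrier V - S)"
    and "T \<subseteq> carrier V \<and> linear_closed K V (carrier V - T)"
  then show "S \<inter> T \<subseteq> carrier V" "linear_closed K V (carrier V - S \<inter> T)"
    using linear_closed_Un[of "carrier V - S" "carrier V - T"] by (auto simp: Diff_Int)
next
  fix UU
  assume *: "\<forall>U\<in>UU. U \<subseteq> carrier V \<and> linear_closed K V (carrier V - U)"
  then show "\<Union>UU \<subseteq> carrier V" by auto
  have "carrier V - \<Union>UU = carrier V \<inter> \<Inter>((\<lambda>U. carrier V - U) ` UU)" by auto
  then show "linear_closed K V (carrier V - \<Union>UU)"
    using linear_closed_Inter[OF assms, of "(\<lambda>U. carrier V - U) ` UU"] * by (metis imageE)
qed

lemma openin_linear_zariski: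
  assumes fin_dim
  shows "openin (linear_zariski K V) U \<longleftrightarrow> U \<subseteq> carrier V \<and> linear_closed K V (carrier V - U)"
  unfolding linear_zariski_def by (simp add: topology_inverse'[OF istopology_linear_zariski[OF assms]])

lemma topspace_linear_zariski:
  assumes fin_dim
  shows "topspace (linear_zariski K V) = carrier V"
proof -
  have "linear_closed K V {}" unfolding linear_closed_def by (intro exI[of _ "{}"]) auto
  then show ?thesis unfolding topspace_def openin_linear_zariski[OF assms] by auto
qed

lemma closedin_linear_zariski:
  assumes fin_dim
  shows "closedin (linear_zariski K V) C \<longleftrightarrow> linear_closed K V C"
  using linear_closed_subset[of C]
  by (auto simp: closedin_def topspace_linear_zariski[OF assms] openin_linear_zariski[OF assms]
      double_diff)

lemma irreducible_component_subspace:
  assumes fd: fin_dim and C: "linear_closed K V C"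
    and B: "B \<in> irreducible_components_of (linear_zariski K V) C"
  shows "VectorSpace.subspace K B V"
proof -
  let ?T = "linear_zariski K V"
  have B': "B \<subseteq> C" "irreducible_in ?T B"
    "\<And>B'. irreducible_in ?T B' \<Longrightarrow> B \<subseteq> B' \<Longrightarrow> B' \<subseteq> C \<Longrightarrow> B' = B"
    using B unfolding irreducible_components_of_def by blast+
  have BV: "B \<subseteq> carrier V" using B'(1) linear_closed_subset[OF C] by (rule subset_trans)
  have cl: "B \<subseteq> ?T closure_of B"
    using BV topspace_linear_zariski[OF fd] by (intro closure_of_subset) auto
  have "irreducible_in ?T (?T closure_of B)"
    unfolding irreducible_in_def
  proof (intro conjI allI impI)
    show "?T closure_of B \<subseteq> topspace ?T" by (rule closure_of_subset_topspace)
    show "?T closure_of B \<noteq> {}" using B'(2) cl unfolding irreducible_in_def by auto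
    fix D E assume DE: "closedin ?T D" "closedin ?T E" "?T closure_of B \<subseteq> D \<union> E"
    then have "B \<subseteq> D \<or> B \<subseteq> E" using B'(2) cl unfolding irreducible_in_def by blast
    then show "?T closure_of B \<subseteq> D \<or> ?T closure_of B \<subseteq> E"
      using DE closure_of_minimal[of B] by auto
  qed
  moreover have "?T closure_of B \<subseteq> C"
    using B'(1) C closedin_linear_zariski[OF fd] by (intro closure_of_minimal) auto
  ultimately have "?T closure_of B = B" using B'(3) cl by auto
  then have "closedin ?T B" by (metis closedin_closure_of)
  then obtain F where F: "finite F" "\<And>W. W \<in> F \<Longrightarrow> VectorSpace.subspace K W V" "B = \<Union>F"
    using closedin_linear_zariski[OF fd] unfolding linear_closed_def by auto
  have "finite G \<Longrightarrow> G \<subseteq> F \<Longrightarrow> B \<subseteq> \<Union>G \<Longrightarrow> \<exists>W\<in>G. B \<subseteq> W" for G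
  proof (induction G rule: finite_induct)
    case empty
    then show ?case using B'(2) unfolding irreducible_in_def by auto
  next
    case (insert W G)
    have "linear_closed K V W" "linear_closed K V (\<Union>G)"
      unfolding linear_closed_def using insert.prems(1) insert.hyps(1) F(2)
      by (intro exI[of _ "{W}"] exI[of _ G]; auto)+
    then have "B \<subseteq> W \<or> B \<subseteq> \<Union>G"
      using B'(2) insert.prems(2) closedin_linear_zariski[OF fd]
      unfolding irreducible_in_def by auto
    then show ?case using insert by auto
  qed
  from this[OF F(1) subset_refl] F(3) obtain W where "W \<in> F" "B \<subseteq> W" by auto
  then have "B = W" using F(3) by auto
  then show ?thesis using F(2) \<open>W \<in> F\<close> by auto
qed

end


section \<open>The linear hull of a linear representation\<close>

abbreviation row_space_zariski :: "'k::field itself \<Rightarrow> nat \<Rightarrow> 'k vec topology" where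
  "row_space_zariski k n \<equiv> linear_zariski class_ring (module_vec k n)"

definition linear_hull :: "nat \<Rightarrow> 'k::field vec \<Rightarrow> ('x list \<Rightarrow> 'k mat) \<Rightarrow> 'k vec set" where
  "linear_hull n u \<mu> = row_space_zariski TYPE('k) n closure_of (range (\<lambda>w. mult_vec_mat u (\<mu> w)))"

definition linear_hull_dim :: "nat \<Rightarrow> 'k::field vec \<Rightarrow> ('x list \<Rightarrow> 'k mat) \<Rightarrow> ereal" where
  "linear_hull_dim n u \<mu> = linear_zariski_dim class_ring (module_vec TYPE('k) n) (linear_hull n u \<mu>)"


section \<open>Weighted automata\<close>

text \<open>Only the values of the three weight maps on \<open>states\<close> matter.\<close>

record ('q, 'x, 'k) weighted_automaton =
  states :: "'q set"
  init_weight :: "'q \<Rightarrow> 'k"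
  edge_weight :: "'q \<Rightarrow> 'x \<Rightarrow> 'q \<Rightarrow> 'k"
  final_weight :: "'q \<Rightarrow> 'k"

text \<open>The paths \<open>p\<^sub>0, \<dots>, p\<^sub>l\<close> for a word of length \<open>l\<close> are the lists of states of length \<open>l + 1\<close>.\<close>

definition recognizes :: "('q, 'x, 'k::field) weighted_automaton \<Rightarrow> ('x, 'k) series \<Rightarrow> bool" where
  "recognizes A S \<longleftrightarrow>
     (\<forall>w. S w = (\<Sum>p | set p \<subseteq> states A \<and> length p = Suc (length w).
        init_weight A (p ! 0) * (\<Prod>i<length w. edge_weight A (p ! i) (w ! i) (p ! Suc i)) *
        final_weight A (p ! length w)))"

definition deterministic :: "('q, 'x, 'k::field) weighted_automaton \<Rightarrow> bool" where
  "deterministic A \<longleftrightarrow>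
     (\<exists>\<^sub>\<le>\<^sub>1 p. p \<in> states A \<and> init_weight A p \<noteq> 0) \<and>
     (\<forall>p\<in>states A. \<forall>x. \<exists>\<^sub>\<le>\<^sub>1 q. q \<in> states A \<and> edge_weight A p x q \<noteq> 0)"

text \<open>Taking natural numbers as states is no restriction, as any finite set of states can be
  renamed injectively.\<close>

definition deterministically_recognized :: "('x, 'k::field) series \<Rightarrow> bool" where
  "deterministically_recognized S \<longleftrightarrow>
     (\<exists>A :: (nat, 'x, 'k) weighted_automaton.
        finite (states A) \<and> deterministic A \<and> recognizes A S)"

end

theory Submission
  imports Defs "HOL-Library.Function_Algebras"
begin

text \<open>
  Both conditions of the theorem say that the left quotients of \<open>S\<close>, the series
  \<open>w' \<mapsto> S (w w')\<close>, lie on finitely many lines in the vector space of all series.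

  For automata this is a weighted version of the Myhill--Nerode theorem. Reading a word in a
  deterministic automaton leads from the initial state to a single state, so the quotient by that
  word is a multiple of the series recognized from that state. Conversely, one representative on each
  line through a nonzero quotient can serve as a state, and the factors of proportionality are the weights
  (\<open>deterministically_recognized_iff_finitely_many_quotient_lines\<close>).

  For representations, a row vector \<open>y\<close> is identified with the series \<open>w \<mapsto> y \<mu>(w) v\<close>. This map is
  linear and takes \<open>u \<mu>(w)\<close> to the quotient of \<open>S\<close> by \<open>w\<close>. If the representation is minimal, the map is
  injective, since a linear dependency between the series of the unit vectors would produce a
  representation of smaller rank (\<open>inj_on_row_series_if_minimal\<close>). So the quotients lie on finitely
  many lines if and only if the vectors \<open>u \<mu>(w)\<close> do (\<open>linear_hull_dim_le_1_iff\<close>). The latter means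
  that their closure has dimension at most \<open>1\<close>, because a closed set is the union of its finitely many
  irreducible components and irreducible sets covered by finitely many lines lie in one of them
  (\<open>closure_dim_le_1_iff\<close>). The argument is uniform in the field; over a finite field both conditions
  hold for every rational series.

  Finally, some minimal representation has to exist, as otherwise the second condition would be
  vacuous. This is where rationality enters: by induction, a rational series lies in the span of
  a finite set of series that is stable under left quotients modulo linear combinations
  (\<open>rational_series_in_quotient_stable_span\<close>), and such a set is a representation
  (\<open>linear_representation_of_quotient_stable\<close>).
\<close>

section \<open>Left quotients of rational series\<close>

definition series_scale :: "'k::field \<Rightarrow> ('x, 'k) series \<Rightarrow> ('x, 'k) series" where
  "series_scale c S = (\<lambda>w. c * S w)"

interpretation series: vector_space series_scale
  by unfold_locales (auto simp: series_scale_def fun_eq_iff algebra_simps)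

lemma sum_series_apply: "(\<Sum>i\<in>I. F i) w = (\<Sum>i\<in>I. F i w)" for F :: "'i \<Rightarrow> ('x, 'k::field) series"
  by (induction I rule: infinite_finite_induct) auto

definition left_quotient :: "'x list \<Rightarrow> ('x, 'k) series \<Rightarrow> ('x, 'k) series" where
  "left_quotient w S = (\<lambda>w'. S (w @ w'))"

lemma left_quotient_Nil [simp]: "left_quotient [] S = S"
  by (simp add: left_quotient_def)

lemma left_quotient_append: "left_quotient (w @ w') S = left_quotient w' (left_quotient w S)"
  by (simp add: left_quotient_def)

lemma left_quotient_scale:
  "left_quotient w (series_scale c S) = series_scale c (left_quotient w S)"
  by (simp add: left_quotient_def series_scale_def)

lemma linear_left_quotient:
  "Vector_Spaces.linear series_scale series_scale (left_quotient w :: ('x, 'k::field) series \<Rightarrow> _)"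
  by unfold_locales (auto simp: left_quotient_def series_scale_def fun_eq_iff)

lemma linear_series_mult:
  "Vector_Spaces.linear series_scale series_scale (\<lambda>S. series_mult S (T :: ('x, 'k::field) series))"
  by unfold_locales
    (auto simp: series_mult_def series_scale_def fun_eq_iff algebra_simps sum.distrib sum_distrib_left)

text \<open>Every stability proof below reduces to generators through this lemma: quotients by a letter and
  multiplication by a fixed series on the right are both linear.\<close>

lemma linear_image_span_subset:
  assumes "Vector_Spaces.linear series_scale series_scale h"
    and "\<And>b. b \<in> B \<Longrightarrow> h b \<in> series.span C" and "f \<in> series.span B"
  shows "h f \<in> series.span C"
proof -
  interpret h: Vector_Spaces.linear series_scale series_scale h by fact
  have "h f \<in> series.span (h ` B)"
    using assms(3) by (simp add: h.span_image)
  moreover have "series.span (h ` B) \<subseteq> series.span C"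
    using assms(2) by (intro series.span_minimal) (auto simp: series.subspace_span)
  ultimately show ?thesis by auto
qed

text \<open>The span of such a set is a submodule for the action of the free monoid by left quotients.\<close>

definition quotient_stable :: "('x, 'k::field) series set \<Rightarrow> bool" where
  "quotient_stable B \<longleftrightarrow> (\<forall>b\<in>B. \<forall>x. left_quotient [x] b \<in> series.span B)"

lemma quotient_stable_span:
  assumes "quotient_stable B" "f \<in> series.span B"
  shows "left_quotient w f \<in> series.span B"
  using assms(2)
proof (induction w arbitrary: f)
  case (Cons x w)
  have "left_quotient [x] f \<in> series.span B"
    using linear_image_span_subset[OF linear_left_quotient _ Cons.prems] assms(1)
    unfolding quotient_stable_def by blast
  then show ?case
    using Cons.IH left_quotient_append[of "[x]" w f] by simp
qed simp

lemma quotient_stable_Un: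
  assumes "quotient_stable B" "quotient_stable C"
  shows "quotient_stable (B \<union> C)"
  using assms series.span_mono[of B "B \<union> C"] series.span_mono[of C "B \<union> C"]
  unfolding quotient_stable_def by auto

text \<open>The first letter of \<open>x w'\<close> belongs either to the factor read by \<open>S\<close>, or to the factor read by \<open>T\<close>,
  in which case \<open>S\<close> contributes its constant coefficient.\<close>

lemma left_quotient_series_mult:
  "left_quotient [x] (series_mult S T) =
    series_mult (left_quotient [x] S) T + series_scale (S []) (left_quotient [x] T)"
  by (auto simp: fun_eq_iff left_quotient_def series_mult_def series_scale_def
      sum.atMost_Suc_shift simp del: sum.atMost_Suc)

lemma series_star_eq_sum:
  assumes "S [] = 0" "length w \<le> N"
  shows "series_star S w = (\<Sum>n\<le>N. series_power S n w)"
  unfolding series_star_def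
  by (rule sum.mono_neutral_left)
    (use assms in \<open>auto simp: not_less[symmetric] series_power_eq_0 intro: ccontr\<close>)

text \<open>Since \<open>S\<close> has no constant coefficient, the coefficient of a given word involves only finitely many
  powers of \<open>S\<close>, so the infinite sum defining the star may be truncated and its summands
  \<open>S\<^sup>n\<^sup>+\<^sup>1\<close> may be factored as \<open>S S\<^sup>n\<close>.\<close>

lemma series_star_unfold:
  assumes "S [] = 0"
  shows "series_star S = series_one + series_mult S (series_star S)"
proof (rule ext)
  fix w
  have "series_star S w = (\<Sum>n\<le>Suc (length w). series_power S n w)"
    using assms by (intro series_star_eq_sum) auto
  also have "\<dots> = series_one w + (\<Sum>n\<le>length w. series_mult S (series_power S n) w)"
    by (simp add: sum.atMost_Suc_shift del: sum.atMost_Suc)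
  also have "(\<Sum>n\<le>length w. series_mult S (series_power S n) w) =
      (\<Sum>i\<le>length w. S (take i w) * (\<Sum>n\<le>length w. series_power S n (drop i w)))"
    unfolding series_mult_def sum_distrib_left by (rule sum.swap)
  also have "\<dots> = series_mult S (series_star S) w"
    unfolding series_mult_def
    by (intro sum.cong refl arg_cong2[where f = "(*)"] series_star_eq_sum[symmetric]) (auto simp: assms)
  finally show "series_star S w = (series_one + series_mult S (series_star S)) w" by simp
qed

lemma left_quotient_series_star:
  assumes "S [] = 0"
  shows "left_quotient [x] (series_star S) = series_mult (left_quotient [x] S) (series_star S)"
proof -
  have "left_quotient [x] (series_star S) = left_quotient [x] (series_mult S (series_star S))"
    using arg_cong[OF series_star_unfold[of S, OF assms], of "left_quotient [x]"]
    by (simp add: left_quotient_def series_one_def)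
  then show ?thesis
    unfolding left_quotient_series_mult by (simp add: assms series_scale_def fun_eq_iff)
qed

definition monomial_series :: "'x list \<Rightarrow> ('x, 'k::field) series" where
  "monomial_series v w = (if w = v then 1 else 0)"

text \<open>A quotient of a monomial by a letter is zero or the monomial of a shorter suffix, so the monomials
  of all suffixes of words in the support suffice.\<close>

lemma polynomial_in_quotient_stable_span:
  fixes P :: "('x, 'k::field) series"
  assumes "finite {w. P w \<noteq> 0}"
  shows "\<exists>B. finite B \<and> quotient_stable B \<and> P \<in> series.span B"
proof -
  define Y where "Y = (\<Union>w\<in>{w. P w \<noteq> 0}. (\<lambda>i. drop i w) ` {..length w})"
  have finY: "finite Y" unfolding Y_def using assms by auto
  have suffix: "w \<in> Y" if xw: "x # w \<in> Y" for x w
  proof -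
    obtain v i where v: "P v \<noteq> 0" "x # w = drop i v"
      using xw unfolding Y_def by auto
    then have "w = drop (Suc i) v" by (metis drop_Suc list.sel(3) tl_drop)
    moreover have "Suc i \<le> length v" using v(2) by (metis Suc_leI drop_eq_Nil leI list.distinct(1))
    ultimately show ?thesis using v(1) unfolding Y_def by auto
  qed
  have "quotient_stable (monomial_series ` Y :: ('x, 'k) series set)"
    unfolding quotient_stable_def
  proof (intro ballI allI)
    fix b :: "('x, 'k) series" and x
    assume "b \<in> monomial_series ` Y"
    then obtain v where v: "v \<in> Y" "b = monomial_series v" by auto
    show "left_quotient [x] b \<in> series.span (monomial_series ` Y)"
    proof (cases "\<exists>w. v = x # w")
      case True
      then obtain w where w: "v = x # w" by auto
      then have "left_quotient [x] b = monomial_series w"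
        by (auto simp: v(2) left_quotient_def monomial_series_def fun_eq_iff)
      then show ?thesis using suffix[of x w] v(1) w by (auto intro: series.span_base)
    next
      case False
      then have "left_quotient [x] b = 0"
        by (auto simp: v(2) left_quotient_def monomial_series_def fun_eq_iff)
      then show ?thesis by (simp add: series.span_zero)
    qed
  qed
  moreover have "P \<in> series.span (monomial_series ` Y)"
  proof -
    have "P = (\<Sum>v | P v \<noteq> 0. series_scale (P v) (monomial_series v))"
    proof
      fix w
      have "(\<Sum>v | P v \<noteq> 0. series_scale (P v) (monomial_series v)) w =
          (\<Sum>v | P v \<noteq> 0. if v = w then P v else 0)"
        unfolding sum_series_apply by (intro sum.cong) (auto simp: series_scale_def monomial_series_def)
      then show "P w = (\<Sum>v | P v \<noteq> 0. series_scale (P v) (monomial_series v)) w"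
        using assms by (simp add: sum.delta)
    qed
    also have "\<dots> \<in> series.span (monomial_series ` Y)"
    proof (intro series.span_sum series.span_scale series.span_base imageI)
      fix v assume "v \<in> {v. P v \<noteq> 0}"
      then show "v \<in> Y" unfolding Y_def by (auto intro!: bexI[of _ v] image_eqI[of _ _ 0])
    qed
    finally show ?thesis .
  qed
  ultimately show ?thesis using finY by blast
qed

text \<open>Induction over the rational operations. With stable sets \<open>B\<close> for \<open>S\<close> and \<open>C\<close> for \<open>T\<close>, the product
  \<open>S T\<close> is handled by \<open>B T \<union> C\<close> and the star of \<open>S\<close> by \<open>B S\<^sup>* \<union> {S\<^sup>*}\<close>: the product rule for
  quotients and \<open>S\<^sup>* = 1 + S S\<^sup>*\<close> show that these sets are stable.\<close>

theorem rational_series_in_quotient_stable_span: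
  assumes "rational_series S"
  shows "\<exists>B. finite B \<and> quotient_stable B \<and> S \<in> series.span B"
  using assms
proof (induction rule: rational_series.induct)
  case (polynomial P)
  then show ?case by (rule polynomial_in_quotient_stable_span)
next
  case (add S T)
  then obtain B C where *: "finite B" "quotient_stable B" "S \<in> series.span B"
    "finite C" "quotient_stable C" "T \<in> series.span C" by blast
  have "S + T \<in> series.span (B \<union> C)"
    using *(3,6) series.span_mono[of B "B \<union> C"] series.span_mono[of C "B \<union> C"]
    by (intro series.span_add) auto
  then show ?case
    using * quotient_stable_Un by (intro exI[of _ "B \<union> C"]) (auto simp: plus_fun_def)
next
  case (uminus S)
  then show ?case using series.span_neg by (fastforce simp: fun_Compl_def)
next
  case (mult S T)
  then obtain B C where *: "finite B" "quotient_stable B" "S \<in> series.span B"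
    "finite C" "quotient_stable C" "T \<in> series.span C" by blast
  let ?D = "(\<lambda>b. series_mult b T) ` B \<union> C"
  have mult: "series_mult f T \<in> series.span ?D" if "f \<in> series.span B" for f
    by (rule linear_image_span_subset[OF linear_series_mult _ that]) (auto intro: series.span_base)
  have C: "series.span C \<subseteq> series.span ?D" by (rule series.span_mono) auto
  have "left_quotient [x] d \<in> series.span ?D" if d: "d \<in> ?D" for d x
    using d
  proof
    assume "d \<in> C"
    then show ?thesis using *(5) C unfolding quotient_stable_def by auto
  next
    assume "d \<in> (\<lambda>b. series_mult b T) ` B"
    then obtain b where b: "b \<in> B" "d = series_mult b T" by auto
    show ?thesis unfolding b(2) left_quotient_series_mult
      using *(2) b(1) quotient_stable_span[OF *(5,6)] C
      by (intro series.span_add series.span_scale mult) (auto simp: quotient_stable_def)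
  qed
  then show ?case
    using * mult by (intro exI[of _ ?D]) (auto simp: quotient_stable_def)
next
  case (star S)
  then obtain B where *: "finite B" "quotient_stable B" "S \<in> series.span B" by blast
  let ?D = "insert (series_star S) ((\<lambda>b. series_mult b (series_star S)) ` B)"
  have mult: "series_mult f (series_star S) \<in> series.span ?D" if "f \<in> series.span B" for f
    by (rule linear_image_span_subset[OF linear_series_mult _ that]) (auto intro: series.span_base)
  have star': "left_quotient [x] (series_star S) \<in> series.span ?D" for x
    unfolding left_quotient_series_star[of S, OF star.hyps(2)]
    by (intro mult quotient_stable_span[OF *(2,3)])
  have "left_quotient [x] d \<in> series.span ?D" if d: "d \<in> ?D" for d x
    using d
  proof
    assume "d \<in> (\<lambda>b. series_mult b (series_star S)) ` B"
    then obtain b where b: "b \<in> B" "d = series_mult b (series_star S)" by auto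
    show ?thesis unfolding b(2) left_quotient_series_mult
      using *(2) b(1) star'
      by (intro series.span_add series.span_scale mult) (auto simp: quotient_stable_def)
  qed (use star' in simp)
  then show ?case
    using * by (intro exI[of _ ?D]) (auto simp: quotient_stable_def intro: series.span_base)
qed

section \<open>Linear representations and row vectors\<close>

lemma mult_vec_mat_carrier: "A \<in> carrier_mat m n \<Longrightarrow> mult_vec_mat u A \<in> carrier_vec n"
  by (auto simp: mult_vec_mat_def)

lemma mult_vec_mat_scalar_prod:
  assumes A: "A \<in> carrier_mat m n" and u: "u \<in> carrier_vec m" and v: "v \<in> carrier_vec n"
  shows "mult_vec_mat u A \<bullet> v = u \<bullet> (A *\<^sub>v v)"
proof -
  have "mult_vec_mat u A = transpose_mat A *\<^sub>v u"
    using A u by (intro eq_vecI) (auto simp: mult_vec_mat_def comm_scalar_prod[of _ m])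
  then show ?thesis using transpose_vec_mult_scalar[OF A v u] by simp
qed

text \<open>The elements of \<open>B\<close> become the coordinates: the \<open>i\<close>-th row of the matrix of a letter expresses the
  quotient of the \<open>i\<close>-th element of \<open>B\<close> in terms of \<open>B\<close>, and the final vector collects the constant
  coefficients. The set need not be independent, and the rank is exactly its cardinality, which is
  what makes the comparison with a minimal representation possible.\<close>

lemma linear_representation_of_quotient_stable:
  fixes S :: "('x, 'k::field) series"
  assumes fin: "finite B" and stable: "quotient_stable B" and S: "S \<in> series.span B"
  shows "\<exists>u \<mu> v. linear_representation S (card B) u \<mu> v"
proof -
  define n where "n = card B"
  obtain F where F: "bij_betw F {0..<n} B"
    using ex_bij_betw_nat_finite[OF fin] unfolding n_def by auto
  have coords: "\<exists>c. f = (\<Sum>i=0..<n. series_scale (c i) (F i))" if f: "f \<in> series.span B" for f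
  proof -
    obtain c where "f = (\<Sum>b\<in>B. series_scale (c b) b)"
      using f unfolding series.span_finite[OF fin] by auto
    also have "\<dots> = (\<Sum>i=0..<n. series_scale (c (F i)) (F i))"
      using sum.reindex_bij_betw[OF F, of "\<lambda>b. series_scale (c b) b"] by simp
    finally show ?thesis by (rule exI[of _ "\<lambda>i. c (F i)"])
  qed
  have "\<forall>x i. \<exists>c. i < n \<longrightarrow> left_quotient [x] (F i) = (\<Sum>j=0..<n. series_scale (c j) (F j))"
  proof (intro allI)
    fix x i
    show "\<exists>c. i < n \<longrightarrow> left_quotient [x] (F i) = (\<Sum>j=0..<n. series_scale (c j) (F j))"
    proof (cases "i < n")
      case True
      then have "F i \<in> B" using bij_betwE[OF F] by auto
      then have "left_quotient [x] (F i) \<in> series.span B"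
        using stable unfolding quotient_stable_def by auto
      from coords[OF this] show ?thesis by blast
    qed simp
  qed
  then obtain E where E: "\<And>x i. i < n \<Longrightarrow>
      left_quotient [x] (F i) = (\<Sum>j=0..<n. series_scale (E x i j) (F j))"
    by metis
  obtain c where c: "S = (\<Sum>i=0..<n. series_scale (c i) (F i))" using coords[OF S] by auto
  define M where "M x = mat n n (\<lambda>(i, j). E x i j)" for x
  define \<mu> where "\<mu> w = foldr (\<lambda>x A. M x * A) w (1\<^sub>m n)" for w
  define u where "u = vec n c"
  define v where "v = vec n (\<lambda>i. F i [])"
  have M: "M x \<in> carrier_mat n n" for x by (simp add: M_def)
  have \<mu>: "\<mu> w \<in> carrier_mat n n" for w
    by (induction w) (auto simp: \<mu>_def intro!: mult_carrier_mat[OF M])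
  have \<mu>_Cons: "\<mu> (x # w) = M x * \<mu> w" for x w by (simp add: \<mu>_def)
  have \<mu>_append: "\<mu> (w @ w') = \<mu> w * \<mu> w'" for w w'
  proof (induction w)
    case Nil
    then show ?case using \<mu>[of w'] by (simp add: \<mu>_def)
  next
    case (Cons x w)
    then show ?case using assoc_mult_mat[OF M \<mu> \<mu>] by (simp add: \<mu>_Cons)
  qed
  have v: "v \<in> carrier_vec n" and u: "u \<in> carrier_vec n" by (auto simp: v_def u_def)
  have \<mu>v: "\<mu> w *\<^sub>v v = vec n (\<lambda>i. F i w)" for w
  proof (induction w)
    case Nil
    then show ?case using v by (simp add: \<mu>_def v_def)
  next
    case (Cons x w)
    have "F i (x # w) = (\<Sum>j=0..<n. E x i j * F j w)" if "i < n" for i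
      using fun_cong[OF E[OF that, of x], of w]
      by (simp add: left_quotient_def sum_series_apply series_scale_def)
    then have "M x *\<^sub>v vec n (\<lambda>i. F i w) = vec n (\<lambda>i. F i (x # w))"
      by (intro eq_vecI) (auto simp: M_def scalar_prod_def)
    then show ?case using Cons assoc_mult_mat_vec[OF M \<mu> v] by (simp add: \<mu>_Cons)
  qed
  have "S w = mult_vec_mat u (\<mu> w) \<bullet> v" for w
    unfolding mult_vec_mat_scalar_prod[OF \<mu> u v] \<mu>v
    by (simp add: c u_def scalar_prod_def sum_series_apply series_scale_def)
  then have "linear_representation S n u \<mu> v"
    unfolding linear_representation_def free_monoid_rep_def
    using u v \<mu> \<mu>_append by (auto simp: \<mu>_def)
  then show ?thesis unfolding n_def by blast
qed

text \<open>The series represented when the initial vector of a representation is replaced by \<open>y\<close>. It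
  identifies the action of the matrices on row vectors with the action of words by left quotients.\<close>

definition row_series :: "('x list \<Rightarrow> 'k::field mat) \<Rightarrow> 'k vec \<Rightarrow> 'k vec \<Rightarrow> ('x, 'k) series" where
  "row_series \<mu> v y = (\<lambda>w. y \<bullet> (\<mu> w *\<^sub>v v))"

context
  fixes S :: "('x, 'k::field) series" and n u \<mu> v
  assumes rep: "linear_representation S n u \<mu> v"
begin

lemma rep_carrier: "u \<in> carrier_vec n" "v \<in> carrier_vec n" "\<mu> w \<in> carrier_mat n n"
  using rep unfolding linear_representation_def free_monoid_rep_def by auto

lemma rep_mult_vec_carrier: "\<mu> w *\<^sub>v v \<in> carrier_vec n"
  by (rule mult_mat_vec_carrier[OF rep_carrier(3,2)])

lemma row_series_init: "row_series \<mu> v u = S"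
  using rep mult_vec_mat_scalar_prod[OF rep_carrier(3,1,2)]
  unfolding row_series_def linear_representation_def by auto

lemma left_quotient_row_series:
  assumes y: "y \<in> carrier_vec n"
  shows "left_quotient w (row_series \<mu> v y) = row_series \<mu> v (mult_vec_mat y (\<mu> w))"
proof
  fix w'
  have "\<mu> (w @ w') = \<mu> w * \<mu> w'"
    using rep unfolding linear_representation_def free_monoid_rep_def by auto
  then have "\<mu> (w @ w') *\<^sub>v v = \<mu> w *\<^sub>v (\<mu> w' *\<^sub>v v)"
    using assoc_mult_mat_vec[OF rep_carrier(3) rep_carrier(3) rep_carrier(2)] by simp
  then show "left_quotient w (row_series \<mu> v y) w' = row_series \<mu> v (mult_vec_mat y (\<mu> w)) w'"
    using mult_vec_mat_scalar_prod[OF rep_carrier(3) y rep_mult_vec_carrier]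
    by (simp add: left_quotient_def row_series_def)
qed

lemma row_series_smult:
  assumes "y \<in> carrier_vec n"
  shows "row_series \<mu> v (a \<cdot>\<^sub>v y) = series_scale a (row_series \<mu> v y)"
  using assms rep_mult_vec_carrier carrier_vecD[OF rep_mult_vec_carrier]
  by (auto simp: row_series_def series_scale_def)

lemma row_series_eq_sum:
  assumes "y \<in> carrier_vec n"
  shows "row_series \<mu> v y = (\<Sum>i=0..<n. series_scale (y $ i) (\<lambda>w. (\<mu> w *\<^sub>v v) $ i))"
  using carrier_vecD[OF rep_mult_vec_carrier]
  unfolding fun_eq_iff row_series_def scalar_prod_def sum_series_apply series_scale_def by simp

text \<open>Minimality makes row vectors distinguishable by their series. The series of the \<open>n\<close> unit vectors
  form a quotient stable set whose span contains \<open>S\<close>. Two of them being equal, or one of them being a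
  combination of the others, would leave a smaller set with the same span, hence a representation of
  rank below \<open>n\<close>. So these series are independent, and they determine the coordinates.\<close>

lemma inj_on_row_series_if_minimal:
  assumes min: "minimal_linear_representation S n u \<mu> v"
  shows "inj_on (row_series \<mu> v) (carrier_vec n)"
proof -
  define F where "F i = (\<lambda>w. (\<mu> w *\<^sub>v v) $ i)" for i
  define B where "B = F ` {0..<n}"
  have row: "row_series \<mu> v y = (\<Sum>i=0..<n. series_scale (y $ i) (F i))" if "y \<in> carrier_vec n" for y
    using row_series_eq_sum[OF that] unfolding F_def .
  have span: "row_series \<mu> v y \<in> series.span B" if "y \<in> carrier_vec n" for y
    unfolding row[OF that] B_def by (intro series.span_sum series.span_scale series.span_base) auto
  have S: "S \<in> series.span B" using span[OF rep_carrier(1)] row_series_init by simp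
  have stable: "quotient_stable B"
    unfolding quotient_stable_def
  proof (intro ballI allI)
    fix b x assume "b \<in> B"
    then obtain i where i: "i < n" "b = F i" unfolding B_def by auto
    have "b = row_series \<mu> v (unit_vec n i)"
      using i rep_mult_vec_carrier by (simp add: row_series_def F_def)
    then show "left_quotient [x] b \<in> series.span B"
      using left_quotient_row_series[of "unit_vec n i" "[x]"] span mult_vec_mat_carrier[OF rep_carrier(3)]
      by simp
  qed
  have fin: "finite B" unfolding B_def by simp
  have least: "n \<le> card C" if "finite C" "quotient_stable C" "S \<in> series.span C" for C
    using linear_representation_of_quotient_stable[OF that] min
    unfolding minimal_linear_representation_def by blast
  have card: "card B = n"
    using least[OF fin stable S] card_image_le[of "{0..<n}" F] unfolding B_def by simp
  then have inj: "inj_on F {0..<n}"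
    unfolding B_def by (intro eq_card_imp_inj_on) auto
  have indep: "series.independent B"
  proof
    assume "series.dependent B"
    then obtain b where b: "b \<in> B" "b \<in> series.span (B - {b})"
      unfolding series.dependent_def by auto
    have eq: "series.span (B - {b}) = series.span B"
      using series.span_redundant[OF b(2)] b(1) by (simp add: insert_absorb)
    then have "quotient_stable (B - {b})" using stable unfolding quotient_stable_def by auto
    then have "n \<le> card (B - {b})" using least[of "B - {b}"] fin S eq by auto
    then show False using card b(1) fin card_Diff1_less[OF fin b(1)] by simp
  qed
  show ?thesis
  proof (rule inj_onI)
    fix y z assume yz: "y \<in> carrier_vec n" "z \<in> carrier_vec n" "row_series \<mu> v y = row_series \<mu> v z"
    let ?g = "inv_into {0..<n} F"
    have g: "?g (F i) = i" if "i < n" for i using inj that by (auto intro: inv_into_f_f)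
    have "(\<Sum>b\<in>B. series_scale (y $ ?g b - z $ ?g b) b) = (\<Sum>i=0..<n. series_scale (y $ i - z $ i) (F i))"
      unfolding B_def using inj g by (subst sum.reindex) auto
    also have "\<dots> = row_series \<mu> v y - row_series \<mu> v z"
      unfolding row[OF yz(1)] row[OF yz(2)] by (simp add: series.scale_left_diff_distrib sum_subtractf)
    also have "\<dots> = 0" using yz(3) by simp
    \<comment> \<open>Independence turns the vanishing combination into the equality of all coordinates.\<close>
    finally have "y $ ?g b - z $ ?g b = 0" if "b \<in> B" for b
      by (rule series.independentD[OF indep fin subset_refl _ that])
    then have "y $ i = z $ i" if "i < n" for i using g[OF that] that unfolding B_def by force
    then show "y = z" using yz(1,2) by (intro eq_vecI) auto
  qed
qed

end

lemma ex_minimal_linear_representation: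
  assumes "rational_series S"
  shows "\<exists>n u \<mu> v. minimal_linear_representation S n u \<mu> v"
proof -
  let ?P = "\<lambda>n. \<exists>u \<mu> v. linear_representation S n u \<mu> v"
  have "\<exists>n. ?P n"
    using rational_series_in_quotient_stable_span[OF assms] linear_representation_of_quotient_stable
    by blast
  then have "?P (LEAST n. ?P n)" by (rule LeastI_ex)
  then obtain u \<mu> v where "linear_representation S (LEAST n. ?P n) u \<mu> v" by blast
  moreover have "(LEAST n. ?P n) \<le> n'" if "linear_representation S n' u' \<mu>' v'" for n' u' \<mu>' v'
    using that by (intro Least_le) blast
  ultimately show ?thesis unfolding minimal_linear_representation_def by blast
qed

section \<open>Deterministic automata and lines of quotients\<close>

text \<open>The quotients of \<open>S\<close> lie on finitely many lines of the space of series. This is the condition to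
  which both sides of the main equivalence are reduced.\<close>

definition finitely_many_quotient_lines :: "('x, 'k::field) series \<Rightarrow> bool" where
  "finitely_many_quotient_lines S \<longleftrightarrow>
     (\<exists>R. finite R \<and> (\<forall>w. \<exists>r\<in>R. \<exists>c. left_quotient w S = series_scale c r))"

text \<open>The behaviour of the automaton started at state \<open>p\<close> with weight \<open>1\<close>.\<close>

fun state_series :: "('q, 'x, 'k::field) weighted_automaton \<Rightarrow> 'q \<Rightarrow> ('x, 'k) series" where
  "state_series A p [] = final_weight A p"
| "state_series A p (x # w) = (\<Sum>q\<in>states A. edge_weight A p x q * state_series A q w)"

lemma left_quotient_state_series:
  "left_quotient [x] (state_series A p) =
    (\<Sum>q\<in>states A. series_scale (edge_weight A p x q) (state_series A q))"
  by (auto simp: left_quotient_def fun_eq_iff sum_series_apply series_scale_def)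

text \<open>The initial weight \<open>I\<close> is arbitrary so that the induction on the word can absorb the weight of the
  first edge into it.\<close>

lemma sum_paths_eq_state_series:
  assumes fin: "finite (states A)"
  shows "(\<Sum>p | set p \<subseteq> states A \<and> length p = Suc (length w).
      I (p ! 0) * (\<Prod>i<length w. edge_weight A (p ! i) (w ! i) (p ! Suc i)) *
      final_weight A (p ! length w)) =
    (\<Sum>q\<in>states A. I q * state_series A q w)"
proof (induction w arbitrary: I)
  case Nil
  have "{p. set p \<subseteq> states A \<and> length p = Suc 0} = (\<lambda>q. [q]) ` states A"
    by (auto simp: length_Suc_conv)
  then show ?case by (simp add: sum.reindex inj_on_def)
next
  case (Cons x w)
  let ?Q = "states A"
  let ?P = "{p. set p \<subseteq> ?Q \<and> length p = Suc (length w)}"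
  let ?t = "\<lambda>p. (\<Prod>i<length w. edge_weight A (p ! i) (w ! i) (p ! Suc i)) * final_weight A (p ! length w)"
  have paths: "{p. set p \<subseteq> ?Q \<and> length p = Suc (length (x # w))} = (\<lambda>(q, p). q # p) ` (?Q \<times> ?P)"
    by (auto simp: length_Suc_conv image_iff)
  have inj: "inj_on (\<lambda>(q, p). q # p) (?Q \<times> ?P)" by (auto simp: inj_on_def)
  have "(\<Sum>p | set p \<subseteq> ?Q \<and> length p = Suc (length (x # w)).
      I (p ! 0) * (\<Prod>i<length (x # w). edge_weight A (p ! i) ((x # w) ! i) (p ! Suc i)) *
      final_weight A (p ! length (x # w))) =
    (\<Sum>(q, p)\<in>?Q \<times> ?P. I q * edge_weight A q x (p ! 0) * ?t p)"
    unfolding paths sum.reindex[OF inj]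
    by (intro sum.cong refl) (auto simp: prod.lessThan_Suc_shift mult.assoc simp del: prod.lessThan_Suc)
  also have "\<dots> = (\<Sum>q\<in>?Q. I q * (\<Sum>p\<in>?P. edge_weight A q x (p ! 0) * ?t p))"
    by (simp add: sum.cartesian_product[symmetric] sum_distrib_left mult.assoc)
  also have "\<dots> = (\<Sum>q\<in>?Q. I q * state_series A q (x # w))"
    using Cons.IH[of "edge_weight A _ x"] by (simp add: mult.assoc)
  finally show ?case .
qed

lemma recognizes_iff_state_series:
  assumes "finite (states A)"
  shows "recognizes A S \<longleftrightarrow> S = (\<Sum>q\<in>states A. series_scale (init_weight A q) (state_series A q))"
  unfolding recognizes_def sum_paths_eq_state_series[OF assms]
  by (auto simp: fun_eq_iff sum_series_apply series_scale_def)

text \<open>The combination has at most one term, so it lies on the line of some \<open>F q\<close>; the element \<open>0\<close> accounts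
  for the case without any term, in particular for empty \<open>Q\<close>.\<close>

lemma sum_with_at_most_one_nonzero_weight:
  assumes fin: "finite Q" and uniq: "\<exists>\<^sub>\<le>\<^sub>1 q. q \<in> Q \<and> e q \<noteq> 0"
  shows "\<exists>r\<in>insert 0 (F ` Q). \<exists>c. (\<Sum>q\<in>Q. series_scale (e q) (F q)) = series_scale c r"
proof (cases "\<exists>q\<in>Q. e q \<noteq> 0")
  case True
  then obtain q where q: "q \<in> Q" "e q \<noteq> 0" by auto
  have "(\<Sum>q\<in>Q. series_scale (e q) (F q)) = (\<Sum>q'\<in>{q}. series_scale (e q') (F q'))"
    using fin q uniq by (intro sum.mono_neutral_right) (auto simp: Uniq_def)
  then show ?thesis using q(1) by auto
next
  case False
  then have "(\<Sum>q\<in>Q. series_scale (e q) (F q)) = series_scale 0 0" by simp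
  then show ?thesis by blast
qed

text \<open>Determinism means that reading a letter sends the line of a state to the line of another state, or
  to zero. So the lines of the states contain all quotients of \<open>S\<close>.\<close>

lemma deterministic_imp_finitely_many_quotient_lines:
  assumes fin: "finite (states A)" and det: "deterministic A" and rec: "recognizes A S"
  shows "finitely_many_quotient_lines S"
proof -
  define R where "R = insert 0 (state_series A ` states A)"
  have start: "\<exists>r\<in>R. \<exists>c. S = series_scale c r"
    using sum_with_at_most_one_nonzero_weight[OF fin, of "init_weight A" "state_series A"] rec det
    unfolding R_def recognizes_iff_state_series[OF fin] deterministic_def by simp
  have step: "\<exists>r'\<in>R. \<exists>c. left_quotient [x] r = series_scale c r'" if r: "r \<in> R" for r x
  proof (cases "r = 0")
    case True
    then have "left_quotient [x] r = series_scale 0 0" by (simp add: left_quotient_def fun_eq_iff)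
    then show ?thesis unfolding R_def by blast
  next
    case False
    then obtain p where p: "p \<in> states A" "r = state_series A p" using r unfolding R_def by auto
    show ?thesis
      unfolding p(2) left_quotient_state_series R_def
      using det p(1) by (intro sum_with_at_most_one_nonzero_weight[OF fin]) (auto simp: deterministic_def)
  qed
  have "\<exists>r\<in>R. \<exists>c. left_quotient w S = series_scale c r" for w
  proof (induction w rule: rev_induct)
    case Nil
    then show ?case using start by simp
  next
    case (snoc x w)
    then obtain r c where r: "r \<in> R" "left_quotient w S = series_scale c r" by auto
    obtain r' c' where "r' \<in> R" "left_quotient [x] r = series_scale c' r'" using step[OF r(1)] by blast
    then have "left_quotient (w @ [x]) S = series_scale (c * c') r'"
      by (simp add: left_quotient_append r(2) left_quotient_scale)
    then show ?case using \<open>r' \<in> R\<close> by blast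
  qed
  then show ?thesis unfolding finitely_many_quotient_lines_def R_def
    using fin by (intro exI[of _ "insert 0 (state_series A ` states A)"]) auto
qed

text \<open>Choosing one nonzero quotient on each line through a nonzero quotient yields a set \<open>R\<close> of pairwise
  non-proportional quotients. Each quotient \<open>f\<close> is then a multiple of at most one \<open>r \<in> R\<close> with nonzero
  coefficient \<open>c f r\<close>. That the representatives are themselves quotients of \<open>S\<close> is essential: their
  quotients are again covered.\<close>

lemma quotient_representatives:
  fixes S :: "('x, 'k::field) series"
  assumes "finitely_many_quotient_lines S"
  shows "\<exists>R c. finite R \<and> R \<subseteq> range (\<lambda>w. left_quotient w S) \<and>
    (\<forall>w. left_quotient w S = (\<Sum>r\<in>R. series_scale (c (left_quotient w S) r) r)) \<and>
    (\<forall>w. \<exists>\<^sub>\<le>\<^sub>1 r. r \<in> R \<and> c (left_quotient w S) r \<noteq> 0)"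
proof -
  obtain R0 where R0: "finite R0" "\<And>w. \<exists>r\<in>R0. \<exists>c. left_quotient w S = series_scale c r"
    using assms unfolding finitely_many_quotient_lines_def by auto
  define N where "N = range (\<lambda>w. left_quotient w S) - {0}"
  have span_eq: "series.span {f} = series.span {r}" if "f \<noteq> 0" "f = series_scale c r" for f r c
  proof -
    have "c \<noteq> 0" using that by auto
    then have "r = series_scale (inverse c) f" using that(2) by simp
    then have "f \<in> series.span {r}" "r \<in> series.span {f}"
      using that(2) by (auto simp: series.span_singleton)
    then show ?thesis by (simp add: series.span_eq)
  qed
  \<comment> \<open>Lines are the spans of single series; a representative is chosen for each line, not for each
    quotient, so that proportional quotients share it.\<close>
  define rep where "rep L = (SOME f. f \<in> N \<and> series.span {f} = L)" for L
  have rep: "rep (series.span {f}) \<in> N" "series.span {rep (series.span {f})} = series.span {f}"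
    if "f \<in> N" for f
  proof -
    have "rep (series.span {f}) \<in> N \<and> series.span {rep (series.span {f})} = series.span {f}"
      unfolding rep_def by (rule someI[of _ f]) (simp add: that)
    then show "rep (series.span {f}) \<in> N" "series.span {rep (series.span {f})} = series.span {f}"
      by simp_all
  qed
  define R where "R = rep ` (\<lambda>f. series.span {f}) ` N"
  have "(\<lambda>f. series.span {f}) ` N \<subseteq> (\<lambda>r. series.span {r}) ` R0"
  proof
    fix L assume "L \<in> (\<lambda>f. series.span {f}) ` N"
    then obtain w where L: "L = series.span {left_quotient w S}" "left_quotient w S \<noteq> 0"
      unfolding N_def by auto
    obtain r c where r: "r \<in> R0" "left_quotient w S = series_scale c r" using R0(2) by blast
    have "L = series.span {r}" unfolding L(1) by (rule span_eq[OF L(2) r(2)])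
    then show "L \<in> (\<lambda>r. series.span {r}) ` R0" using r(1) by simp
  qed
  then have "finite R" unfolding R_def using R0(1) by (meson finite_imageI finite_subset)
  have RN: "R \<subseteq> N" unfolding R_def using rep(1) by auto
  have R_unique: "r = r'" if "r \<in> R" "r' \<in> R" "series.span {r} = series.span {r'}" for r r'
    using that rep(2) unfolding R_def by auto
  define c where "c f r = (if \<exists>a. a \<noteq> 0 \<and> f = series_scale a r
    then SOME a. a \<noteq> 0 \<and> f = series_scale a r else 0)" for f r :: "('x, 'k) series"
  have c: "f = series_scale (c f r) r" if "c f r \<noteq> 0" for f r
    using that someI_ex[of "\<lambda>a. a \<noteq> 0 \<and> f = series_scale a r"] unfolding c_def by (auto split: if_splits)
  have uniq: "\<exists>\<^sub>\<le>\<^sub>1 r. r \<in> R \<and> c f r \<noteq> 0" for f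
  proof (intro Uniq_I)
    fix r r' assume r: "r \<in> R \<and> c f r \<noteq> 0" and r': "r' \<in> R \<and> c f r' \<noteq> 0"
    have "r \<noteq> 0" using r RN unfolding N_def by auto
    then have "f \<noteq> 0" using c[of f r] r by (metis series.scale_eq_0_iff)
    then have "series.span {r} = series.span {r'}"
      using span_eq[of f "c f r" r] span_eq[of f "c f r'" r'] c r r' by metis
    then show "r = r'" using R_unique r r' by auto
  qed
  have sum: "f = (\<Sum>r\<in>R. series_scale (c f r) r)" if f: "f \<in> range (\<lambda>w. left_quotient w S)" for f
  proof (cases "f = 0")
    case True
    have "c f r = 0" if "r \<in> R" for r
      using that RN c[of f r] True unfolding N_def by (metis DiffD2 series.scale_eq_0_iff singletonI subsetD)
    then show ?thesis using True by simp
  next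
    case False
    then have fN: "f \<in> N" using f unfolding N_def by auto
    define r where "r = rep (series.span {f})"
    have r: "r \<in> R" "series.span {r} = series.span {f}"
      unfolding r_def R_def using fN rep(2)[OF fN] by auto
    have "f \<in> series.span {r}" unfolding r(2) by (simp add: series.span_base)
    then obtain a where "f = series_scale a r" unfolding series.span_singleton by auto
    then have "a \<noteq> 0 \<and> f = series_scale a r" using False by auto
    then have "c f r \<noteq> 0"
      using someI[of "\<lambda>a. a \<noteq> 0 \<and> f = series_scale a r" a] unfolding c_def by auto
    have "(\<Sum>r\<in>R. series_scale (c f r) r) = (\<Sum>r'\<in>{r}. series_scale (c f r') r')"
      using \<open>finite R\<close> r(1) \<open>c f r \<noteq> 0\<close> uniq[of f]
      by (intro sum.mono_neutral_right) (auto simp: Uniq_def)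
    then show ?thesis using c[OF \<open>c f r \<noteq> 0\<close>] by simp
  qed
  have "R \<subseteq> range (\<lambda>w. left_quotient w S)" using RN unfolding N_def by blast
  moreover have "left_quotient w S = (\<Sum>r\<in>R. series_scale (c (left_quotient w S) r) r)" for w
    by (rule sum[OF rangeI])
  ultimately show ?thesis using \<open>finite R\<close> uniq by blast
qed

text \<open>A weighted form of the Myhill--Nerode automaton: the states are the representatives of the lines,
  and the edge from \<open>r\<close> labelled \<open>x\<close> leads to the representative proportional to the quotient of \<open>r\<close>
  by \<open>x\<close>, weighted by the factor of proportionality.\<close>

lemma finitely_many_quotient_lines_imp_deterministic:
  fixes S :: "('x, 'k::field) series"
  assumes "finitely_many_quotient_lines S"
  shows "deterministically_recognized S"
proof -
  obtain R c where R: "finite R" "R \<subseteq> range (\<lambda>w. left_quotient w S)"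
    and sum: "\<And>w. left_quotient w S = (\<Sum>r\<in>R. series_scale (c (left_quotient w S) r) r)"
    and uniq: "\<And>w. \<exists>\<^sub>\<le>\<^sub>1 r. r \<in> R \<and> c (left_quotient w S) r \<noteq> 0"
    using quotient_representatives[OF assms] by blast
  obtain F where F: "bij_betw F {0..<card R} R" using ex_bij_betw_nat_finite[OF R(1)] by auto
  define A :: "(nat, 'x, 'k) weighted_automaton" where
    "A = \<lparr>states = {0..<card R}, init_weight = (\<lambda>p. c S (F p)),
      edge_weight = (\<lambda>p x q. c (left_quotient [x] (F p)) (F q)), final_weight = (\<lambda>p. F p [])\<rparr>"
  have st: "states A = {0..<card R}" by (simp add: A_def)
  have sum': "left_quotient w S = (\<Sum>q\<in>states A. series_scale (c (left_quotient w S) (F q)) (F q))" for w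
    using sum[of w] sum.reindex_bij_betw[OF F, of "\<lambda>r. series_scale (c (left_quotient w S) r) r"]
    unfolding st by simp
  have uniq': "\<exists>\<^sub>\<le>\<^sub>1 q. q \<in> states A \<and> c (left_quotient w S) (F q) \<noteq> 0" for w
  proof (intro Uniq_I)
    fix p q assume "p \<in> states A \<and> c (left_quotient w S) (F p) \<noteq> 0"
      and "q \<in> states A \<and> c (left_quotient w S) (F q) \<noteq> 0"
    then show "p = q"
      using uniq[of w] F bij_betwE[OF F] unfolding st Uniq_def bij_betw_def inj_on_def by blast
  qed
  have quot: "\<exists>w. left_quotient [x] (F p) = left_quotient w S" if "p \<in> states A" for p x
  proof -
    have "F p \<in> R" using that bij_betwE[OF F] unfolding st by auto
    then obtain w where "F p = left_quotient w S" using R(2) by auto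
    then show ?thesis by (intro exI[of _ "w @ [x]"]) (simp add: left_quotient_append)
  qed
  have series: "state_series A p w = F p w" if "p \<in> states A" for p w
    using that
  proof (induction w arbitrary: p)
    case Nil
    then show ?case by (simp add: A_def)
  next
    case (Cons x w)
    obtain w' where w': "left_quotient [x] (F p) = left_quotient w' S" using quot[OF Cons.prems] by blast
    have "F p (x # w) = left_quotient w' S w" unfolding w'[symmetric] by (simp add: left_quotient_def)
    also have "\<dots> = (\<Sum>q\<in>states A. series_scale (edge_weight A p x q) (F q)) w"
      using fun_cong[OF sum'[of w'], of w] w' by (simp add: A_def)
    also have "\<dots> = state_series A p (x # w)"
      using Cons.IH by (simp add: sum_series_apply series_scale_def)
    finally show ?case by simp
  qed
  then have "state_series A p = F p" if "p \<in> states A" for p using that by auto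
  then have "S = (\<Sum>q\<in>states A. series_scale (init_weight A q) (state_series A q))"
    using sum'[of "[]"] by (simp add: A_def)
  then have "recognizes A S" by (subst recognizes_iff_state_series) (auto simp: st)
  moreover have "deterministic A"
    unfolding deterministic_def
  proof (intro conjI ballI allI)
    show "\<exists>\<^sub>\<le>\<^sub>1 p. p \<in> states A \<and> init_weight A p \<noteq> 0"
      using uniq'[of "[]"] by (simp add: A_def)
    show "\<exists>\<^sub>\<le>\<^sub>1 q. q \<in> states A \<and> edge_weight A p x q \<noteq> 0" if p: "p \<in> states A" for p x
      using quot[OF p, of x] uniq' by (auto simp: A_def)
  qed
  moreover have "finite (states A)" by (simp add: st)
  ultimately show ?thesis unfolding deterministically_recognized_def by blast
qed

theorem deterministically_recognized_iff_finitely_many_quotient_lines: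
  "deterministically_recognized S \<longleftrightarrow> finitely_many_quotient_lines S"
  using deterministic_imp_finitely_many_quotient_lines finitely_many_quotient_lines_imp_deterministic
  unfolding deterministically_recognized_def by blast

section \<open>Closures of dimension at most one\<close>

context vectorspace
begin

definition line :: "'c \<Rightarrow> 'c set" where
  "line t = {a \<odot>\<^bsub>V\<^esub> t | a. a \<in> carrier K}"

lemma subspace_subset: "VectorSpace.subspace K W V \<Longrightarrow> W \<subseteq> carrier V"
  unfolding VectorSpace.subspace_def submodule_def by auto

lemma subspace_smult_closed:
  "VectorSpace.subspace K W V \<Longrightarrow> a \<in> carrier K \<Longrightarrow> x \<in> W \<Longrightarrow> a \<odot>\<^bsub>V\<^esub> x \<in> W"
  unfolding VectorSpace.subspace_def submodule_def by auto

lemma line_eq_span: "t \<in> carrier V \<Longrightarrow> line t = span {t}"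
proof -
  assume t: "t \<in> carrier V"
  have lincomb: "lincomb a {t} = a t \<odot>\<^bsub>V\<^esub> t" if "a t \<in> carrier K" for a
    using t that unfolding lincomb_def by simp
  show "line t = span {t}"
  proof (intro equalityI subsetI)
    fix x assume "x \<in> line t"
    then obtain a where "a \<in> carrier K" "x = lincomb (\<lambda>_. a) {t}"
      using lincomb[of "\<lambda>_. _"] unfolding line_def by auto
    then show "x \<in> span {t}" unfolding span_def by blast
  next
    fix x assume "x \<in> span {t}"
    then obtain a where "a \<in> {t} \<rightarrow> carrier K" "x = lincomb a {t}"
      using finite_in_span[of "{t}" x] t by auto
    then show "x \<in> line t" using lincomb[of a] unfolding line_def by auto
  qed
qed

lemma subspace_line: "t \<in> carrier V \<Longrightarrow> VectorSpace.subspace K (line t) V"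
  by (simp add: line_eq_span span_is_subspace)

lemma line_zero: "line \<zero>\<^bsub>V\<^esub> = {\<zero>\<^bsub>V\<^esub>}"
  unfolding line_def by (auto intro: exI[of _ "\<zero>\<^bsub>K\<^esub>"])

text \<open>The generator can be taken inside \<open>W\<close>, which is needed when \<open>W\<close> is regarded as a vector space of its
  own: if \<open>W\<close> is nonzero, any nonzero multiple of \<open>t\<close> in \<open>W\<close> generates \<open>W\<close>.\<close>

lemma subspace_of_line_is_line:
  assumes W: "VectorSpace.subspace K W V" and t: "t \<in> carrier V" and "W \<subseteq> line t"
  obtains s where "s \<in> W" "W = line s"
proof (cases "W = {\<zero>\<^bsub>V\<^esub>}")
  case True
  then show ?thesis using that[of "\<zero>\<^bsub>V\<^esub>"] line_zero by auto
next
  case False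
  moreover have "\<zero>\<^bsub>V\<^esub> \<in> W" using W unfolding VectorSpace.subspace_def submodule_def by auto
  ultimately obtain s where s: "s \<in> W" "s \<noteq> \<zero>\<^bsub>V\<^esub>" by auto
  then obtain a where a: "a \<in> carrier K" "s = a \<odot>\<^bsub>V\<^esub> t"
    using assms(3) unfolding line_def by auto
  have "a \<noteq> \<zero>\<^bsub>K\<^esub>" using s(2) a t by auto
  then have inv: "inv\<^bsub>K\<^esub> a \<in> carrier K" "inv\<^bsub>K\<^esub> a \<otimes>\<^bsub>K\<^esub> a = \<one>\<^bsub>K\<^esub>"
    using a(1) by (auto simp: field_Units)
  have "W \<subseteq> line s"
  proof
    fix x assume "x \<in> W"
    then obtain b where b: "b \<in> carrier K" "x = b \<odot>\<^bsub>V\<^esub> t"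
      using assms(3) unfolding line_def by auto
    have "t = inv\<^bsub>K\<^esub> a \<odot>\<^bsub>V\<^esub> s"
      unfolding a(2) using inv a(1) t by (simp add: smult_assoc1[symmetric])
    then have "x = (b \<otimes>\<^bsub>K\<^esub> inv\<^bsub>K\<^esub> a) \<odot>\<^bsub>V\<^esub> s"
      using b inv a t by (metis smult_assoc1 smult_closed)
    then show "x \<in> line s" unfolding line_def using b inv by auto
  qed
  moreover have "line s \<subseteq> W"
    unfolding line_def using s(1) subspace_smult_closed[OF W] by auto
  ultimately show ?thesis using that s(1) by auto
qed

lemma vs_eq_line_if_dim_le_1:
  assumes fin: "finite B" and B: "basis B" and "card B \<le> 1"
  shows "\<exists>t\<in>carrier V. carrier V = line t"
proof (cases "B = {}")
  case True
  then have "carrier V = {\<zero>\<^bsub>V\<^esub>}" using B unfolding basis_def by (simp add: span_empty)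
  then show ?thesis using line_zero by auto
next
  case False
  then have "card B = 1" using assms by (metis One_nat_def card_0_eq le_Suc_eq le_zero_eq)
  then obtain t where "B = {t}" by (auto simp: card_1_singleton_iff)
  then show ?thesis using B line_eq_span[of t] unfolding basis_def by auto
qed

text \<open>A maximal independent subset of \<open>W\<close> generates \<open>W\<close>, since otherwise it could be enlarged.\<close>

lemma subspace_fin_dim:
  assumes fd: fin_dim and W: "VectorSpace.subspace K W V"
  shows "vectorspace.fin_dim K (vs W)"
proof -
  interpret W: vectorspace K "vs W" by (rule subspace_is_vs[OF W])
  have WV: "W \<subseteq> carrier V" by (rule subspace_subset[OF W])
  have sm: "submodule K W V" using W unfolding VectorSpace.subspace_def by auto
  let ?P = "\<lambda>A. A \<subseteq> W \<and> lin_indpt A"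
  have "?P {}" unfolding lin_dep_def by auto
  moreover have "\<forall>A. ?P A \<longrightarrow> card A < Suc dim"
    using li_le_dim(2)[OF fd] WV by (auto simp: less_Suc_eq_le)
  ultimately obtain A where A: "?P A" and max: "\<And>B. ?P B \<Longrightarrow> card B \<le> card A"
    using ex_has_greatest_nat[of ?P "{}" card "Suc dim"] by blast
  have fin: "finite A" using fin_dim_li_fin[OF fd] A WV by auto
  have "W \<subseteq> span A"
  proof (rule ccontr)
    assume "\<not> W \<subseteq> span A"
    then obtain x where x: "x \<in> W" "x \<notin> span A" by auto
    then have "lin_indpt (insert x A)" "x \<notin> A"
      using lin_dep_iff_in_span[of A x] A WV span_mem[of A x] by auto
    then show False using max[of "insert x A"] A x(1) fin by auto
  qed
  moreover have "W.span A = span A" using span_li_not_depend(1)[OF _ sm, of A] A by auto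
  moreover have "span A \<subseteq> W" using A W by (intro span_is_subset) auto
  ultimately have "W.span A = carrier (vs W)" by auto
  then show ?thesis unfolding W.fin_dim_def using fin A by auto
qed

lemma dim_le_1_iff_line:
  assumes fd: fin_dim and W: "VectorSpace.subspace K W V"
  shows "vectorspace.dim K (vs W) \<le> 1 \<longleftrightarrow> (\<exists>t\<in>carrier V. W \<subseteq> line t)"
proof -
  interpret W: vectorspace K "vs W" by (rule subspace_is_vs[OF W])
  have line: "W.line t = line t" for t unfolding W.line_def line_def by simp
  have WV: "W \<subseteq> carrier V" by (rule subspace_subset[OF W])
  show ?thesis
  proof
    assume "W.dim \<le> 1"
    have "W.fin_dim" by (rule subspace_fin_dim[OF fd W])
    then obtain B where B: "finite B" "W.basis B" using W.finite_basis_exists by auto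
    then have "card B \<le> 1" using W.dim_basis \<open>W.dim \<le> 1\<close> by auto
    from W.vs_eq_line_if_dim_le_1[OF B this] show "\<exists>t\<in>carrier V. W \<subseteq> line t"
      using WV by (auto simp: line)
  next
    assume "\<exists>t\<in>carrier V. W \<subseteq> line t"
    then obtain s where s: "s \<in> W" "W = line s"
      using subspace_of_line_is_line[OF W] by metis
    have "W.span {s} = W.line s" using W.line_eq_span[of s] s(1) by simp
    also have "\<dots> = W" unfolding line by (rule s(2)[symmetric])
    finally have "W.span {s} = W" .
    then have "W.dim \<le> card {s}" using s by (intro W.gen_ge_dim) auto
    then show "W.dim \<le> 1" by simp
  qed
qed

lemma linear_closed_Union:
  assumes "finite F" "\<And>W. W \<in> F \<Longrightarrow> VectorSpace.subspace K W V"
  shows "linear_closed K V (\<Union>F)"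
  using assms unfolding linear_closed_def by blast

text \<open>Irreducibility is defined by covers with two closed sets; the extension to finite covers by
  subspaces is by induction.\<close>

lemma irreducible_in_finite_Union:
  assumes fd: fin_dim and B: "irreducible_in (linear_zariski K V) B"
    and "finite F" "\<And>W. W \<in> F \<Longrightarrow> VectorSpace.subspace K W V" "B \<subseteq> \<Union>F"
  shows "\<exists>W\<in>F. B \<subseteq> W"
  using assms(3-)
proof (induction F rule: finite_induct)
  case empty
  then show ?case using B unfolding irreducible_in_def by auto
next
  case (insert W F)
  have "linear_closed K V W" "linear_closed K V (\<Union>F)"
    using linear_closed_Union[of "{W}"] linear_closed_Union[of F] insert by auto
  then have "B \<subseteq> W \<or> B \<subseteq> \<Union>F"
    using B insert.prems(2) closedin_linear_zariski[OF fd] unfolding irreducible_in_def by auto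
  then show ?case using insert by auto
qed

definition irreducible_decomposition :: "'c set \<Rightarrow> 'c set set \<Rightarrow> bool" where
  "irreducible_decomposition C F \<longleftrightarrow> finite F \<and>
     (\<forall>U\<in>F. VectorSpace.subspace K U V \<and> irreducible_in (linear_zariski K V) U) \<and> C = \<Union>F"

lemma irreducible_decomposition_UN:
  assumes "finite G" "\<And>U. U \<in> G \<Longrightarrow> irreducible_decomposition (D U) (E U)" "C = (\<Union>U\<in>G. D U)"
  shows "irreducible_decomposition C (\<Union>U\<in>G. E U)"
proof -
  have "C = \<Union>(\<Union>U\<in>G. E U)"
    using assms(2,3) unfolding irreducible_decomposition_def by auto
  then show ?thesis using assms(1,2) unfolding irreducible_decomposition_def by auto
qed

text \<open>A subspace need not be irreducible: over a finite field, every subspace is the union of finitely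
  many lines. A reducible subspace \<open>W\<close> is covered by its proper intersections with the subspaces
  that make up the two closed sets, and the argument is repeated for these intersections. It ends
  since the bound \<open>k\<close> on the cardinality of independent subsets drops.\<close>

lemma subspace_irreducible_decomposition_aux:
  assumes fd: fin_dim
  shows "VectorSpace.subspace K W V \<Longrightarrow> (\<And>A. A \<subseteq> W \<Longrightarrow> lin_indpt A \<Longrightarrow> card A \<le> k) \<Longrightarrow>
    \<exists>F. irreducible_decomposition W F"
proof (induction k arbitrary: W rule: less_induct)
  case (less k)
  let ?T = "linear_zariski K V"
  show ?case
  proof (cases "irreducible_in ?T W")
    case True
    then have "irreducible_decomposition W {W}"
      using less.prems(1) unfolding irreducible_decomposition_def by simp
    then show ?thesis by (rule exI)
  next
    case False
    moreover have "W \<subseteq> topspace ?T" "W \<noteq> {}"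
      using less.prems(1) topspace_linear_zariski[OF fd]
      unfolding VectorSpace.subspace_def submodule_def by auto
    ultimately obtain C D where CD: "linear_closed K V C" "linear_closed K V D"
      "W \<subseteq> C \<union> D" "\<not> W \<subseteq> C" "\<not> W \<subseteq> D"
      unfolding irreducible_in_def closedin_linear_zariski[OF fd] by auto
    from CD(1,2) obtain F G where FG: "finite F" "\<forall>U\<in>F. VectorSpace.subspace K U V" "C = \<Union>F"
      "finite G" "\<forall>U\<in>G. VectorSpace.subspace K U V" "D = \<Union>G"
      unfolding linear_closed_def by auto
    have "\<exists>E. irreducible_decomposition (W \<inter> U) E" if U: "U \<in> F \<union> G" for U
    proof (rule less.IH)
      show sub: "VectorSpace.subspace K (W \<inter> U) V"
        using less.prems(1) FG(2,5) U by (auto intro: subspace_Int)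
      have "W \<inter> U \<subset> W" using CD(4,5) FG(3,6) U by auto
      then have *: "Suc (card A) \<le> k" if "A \<subseteq> W \<inter> U" "lin_indpt A" for A
        using card_li_proper_subspace[OF fd less.prems(1) sub _ less.prems(2) that] by auto
      have "lin_indpt {}" unfolding lin_dep_def by auto
      from *[OF _ this] show "k - 1 < k" by auto
      show "card A \<le> k - 1" if "A \<subseteq> W \<inter> U" "lin_indpt A" for A
        using *[OF that] by auto
    qed
    then obtain E where E: "\<And>U. U \<in> F \<union> G \<Longrightarrow> irreducible_decomposition (W \<inter> U) (E U)"
      by metis
    have "W = (\<Union>U\<in>F \<union> G. W \<inter> U)" using CD(3) FG(3,6) by auto
    then have "irreducible_decomposition W (\<Union>U\<in>F \<union> G. E U)"
      using FG(1,4) E by (intro irreducible_decomposition_UN[where D = "\<lambda>U. W \<inter> U"]) auto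
    then show ?thesis by (rule exI)
  qed
qed

text \<open>The maximal members of an irreducible decomposition of \<open>C\<close> are irreducible components: an
  irreducible subset of \<open>C\<close> containing one of them lies inside some member, which has to be the same
  one by maximality.\<close>

lemma linear_closed_eq_finite_Union_components:
  assumes fd: fin_dim and C: "linear_closed K V C"
  shows "\<exists>F. finite F \<and> F \<subseteq> irreducible_components_of (linear_zariski K V) C \<and> C = \<Union>F"
proof -
  let ?T = "linear_zariski K V"
  obtain G where G: "finite G" "\<And>W. W \<in> G \<Longrightarrow> VectorSpace.subspace K W V" "C = \<Union>G"
    using C unfolding linear_closed_def by auto
  have "\<exists>F. irreducible_decomposition W F" if "W \<in> G" for W
    using li_le_dim(2)[OF fd] subspace_subset G(2)[OF that]
    by (intro subspace_irreducible_decomposition_aux[OF fd, where k = dim]) auto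
  then obtain E where "\<And>W. W \<in> G \<Longrightarrow> irreducible_decomposition W (E W)" by metis
  then have "irreducible_decomposition C (\<Union>W\<in>G. E W)"
    using G(1,3) by (intro irreducible_decomposition_UN[where D = "\<lambda>W. W"]) auto
  then obtain H where H: "finite H" "\<And>U. U \<in> H \<Longrightarrow> VectorSpace.subspace K U V"
    "\<And>U. U \<in> H \<Longrightarrow> irreducible_in ?T U" and CH: "C = \<Union>H"
    unfolding irreducible_decomposition_def by blast
  define F where "F = {U \<in> H. \<forall>U'\<in>H. U \<subseteq> U' \<longrightarrow> U' = U}"
  have "U \<in> irreducible_components_of ?T C" if "U \<in> F" for U
    unfolding irreducible_components_of_def
  proof (intro CollectI conjI allI impI)
    show "U \<subseteq> C" "irreducible_in ?T U" using that H(3) CH unfolding F_def by auto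
    fix B assume B: "irreducible_in ?T B" "U \<subseteq> B" "B \<subseteq> C"
    then obtain U' where "U' \<in> H" "B \<subseteq> U'"
      using irreducible_in_finite_Union[OF fd B(1) H(1,2)] CH by auto
    then have "U' = U" using B(2) that unfolding F_def by blast
    then show "B = U" using B(2) \<open>B \<subseteq> U'\<close> by blast
  qed
  moreover have "C = \<Union>F"
  proof
    show "C \<subseteq> \<Union>F"
    proof
      fix x assume "x \<in> C"
      then obtain U where U: "U \<in> H" "x \<in> U" using CH by auto
      obtain M where "M \<in> H" "U \<subseteq> M" "\<forall>U'\<in>H. M \<subseteq> U' \<longrightarrow> M = U'"
        using finite_has_maximal2[OF H(1) U(1)] by auto
      then show "x \<in> \<Union>F" using U unfolding F_def by blast
    qed
  qed (use CH in \<open>unfold F_def, blast\<close>)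
  moreover have "finite F" using H(1) unfolding F_def by auto
  ultimately show ?thesis by blast
qed

text \<open>Components of dimension at most \<open>1\<close> are lines or zero, and the closure is a finite union of its components.
  Conversely a finite union of lines is closed, so it contains the closure, and by
  irreducibility each component of the closure fits into a single one of these lines.\<close>

theorem closure_dim_le_1_iff:
  assumes fd: fin_dim and X: "X \<subseteq> carrier V"
  shows "linear_zariski_dim K V (linear_zariski K V closure_of X) \<le> 1 \<longleftrightarrow>
    (\<exists>T. finite T \<and> T \<subseteq> carrier V \<and> X \<subseteq> (\<Union>t\<in>T. line t))"
proof -
  let ?T = "linear_zariski K V"
  let ?C = "?T closure_of X"
  have clC: "linear_closed K V ?C"
    using closedin_closure_of[of ?T X] unfolding closedin_linear_zariski[OF fd] .
  have XC: "X \<subseteq> ?C" using X topspace_linear_zariski[OF fd] by (intro closure_of_subset) auto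
  have sub: "VectorSpace.subspace K W V" if "W \<in> irreducible_components_of ?T ?C" for W
    using irreducible_component_subspace[OF fd clC that] .
  have "linear_zariski_dim K V ?C \<le> 1 \<longleftrightarrow>
    (\<forall>W\<in>irreducible_components_of ?T ?C. vectorspace.dim K (vs W) \<le> 1)"
    unfolding linear_zariski_dim_def SUP_le_iff by (simp add: one_ereal_def)
  also have "\<dots> \<longleftrightarrow> (\<forall>W\<in>irreducible_components_of ?T ?C. \<exists>t\<in>carrier V. W \<subseteq> line t)"
    using dim_le_1_iff_line[OF fd sub] by auto
  also have "\<dots> \<longleftrightarrow> (\<exists>T. finite T \<and> T \<subseteq> carrier V \<and> X \<subseteq> (\<Union>t\<in>T. line t))"
  proof
    assume *: "\<forall>W\<in>irreducible_components_of ?T ?C. \<exists>t\<in>carrier V. W \<subseteq> line t"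
    obtain F where F: "finite F" "F \<subseteq> irreducible_components_of ?T ?C" "?C = \<Union>F"
      using linear_closed_eq_finite_Union_components[OF fd clC] by auto
    have "\<forall>W\<in>F. \<exists>t. t \<in> carrier V \<and> W \<subseteq> line t"
    proof
      fix W assume "W \<in> F"
      then have "W \<in> irreducible_components_of ?T ?C" by (rule subsetD[OF F(2)])
      from bspec[OF * this] show "\<exists>t. t \<in> carrier V \<and> W \<subseteq> line t" by auto
    qed
    from bchoice[OF this] obtain t where
      t: "\<forall>W\<in>F. t W \<in> carrier V \<and> W \<subseteq> line (t W)" by (rule exE)
    show "\<exists>T. finite T \<and> T \<subseteq> carrier V \<and> X \<subseteq> (\<Union>t\<in>T. line t)"
    proof (intro exI conjI)
      show "finite (t ` F)" "t ` F \<subseteq> carrier V" using F(1) t by auto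
      have "\<Union>F \<subseteq> (\<Union>s\<in>t ` F. line s)" using t by auto
      with XC show "X \<subseteq> (\<Union>s\<in>t ` F. line s)" unfolding F(3) by (rule subset_trans)
    qed
  next
    assume "\<exists>T. finite T \<and> T \<subseteq> carrier V \<and> X \<subseteq> (\<Union>t\<in>T. line t)"
    then obtain T where T: "finite T" "T \<subseteq> carrier V" "X \<subseteq> \<Union>(line ` T)" by auto
    have lines: "\<And>W. W \<in> line ` T \<Longrightarrow> VectorSpace.subspace K W V"
      using T(2) subspace_line by auto
    have "linear_closed K V (\<Union>(line ` T))" using T(1) lines by (intro linear_closed_Union) auto
    then have "?C \<subseteq> \<Union>(line ` T)"
      using T(3) closedin_linear_zariski[OF fd] by (intro closure_of_minimal) auto
    show "\<forall>W\<in>irreducible_components_of ?T ?C. \<exists>t\<in>carrier V. W \<subseteq> line t"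
    proof
      fix W assume "W \<in> irreducible_components_of ?T ?C"
      then have "irreducible_in ?T W" "W \<subseteq> ?C" unfolding irreducible_components_of_def by auto
      then obtain L where "L \<in> line ` T" "W \<subseteq> L"
        using irreducible_in_finite_Union[OF fd, of W "line ` T"] lines T(1) \<open>?C \<subseteq> \<Union>(line ` T)\<close>
        by (metis finite_imageI subset_trans)
      then show "\<exists>t\<in>carrier V. W \<subseteq> line t" using T(2) by auto
    qed
  qed
  finally show ?thesis .
qed

end

section \<open>The linear hull of a minimal representation\<close>

lemma linear_hull_dim_le_1_iff_lines:
  fixes u :: "'k::field vec"
  assumes \<mu>: "\<And>w. \<mu> w \<in> carrier_mat n n"
  shows "linear_hull_dim n u \<mu> \<le> 1 \<longleftrightarrow>
    (\<exists>T. finite T \<and> T \<subseteq> carrier_vec n \<and> (\<forall>w. \<exists>t\<in>T. \<exists>a. mult_vec_mat u (\<mu> w) = a \<cdot>\<^sub>v t))"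
proof -
  interpret V: vec_space "TYPE('k)" n .
  have "range (\<lambda>w. mult_vec_mat u (\<mu> w)) \<subseteq> carrier_vec n"
    using mult_vec_mat_carrier[OF \<mu>] by auto
  moreover have "range (\<lambda>w. mult_vec_mat u (\<mu> w)) \<subseteq> (\<Union>t\<in>T. V.line t) \<longleftrightarrow>
    (\<forall>w. \<exists>t\<in>T. \<exists>a. mult_vec_mat u (\<mu> w) = a \<cdot>\<^sub>v t)" for T
    unfolding V.line_def image_subset_iff by (simp add: module_vec_simps)
  ultimately show ?thesis
    unfolding linear_hull_dim_def linear_hull_def by (simp only: V.closure_dim_le_1_iff[OF V.fin_dim])
qed

text \<open>The correspondence between a row vector and its series is linear, so it maps lines to lines, and it
  sends \<open>u \<mu>(w)\<close> to the quotient of \<open>S\<close> by \<open>w\<close>. Lines of series pull back to lines of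
  row vectors because the correspondence is injective for a minimal representation.\<close>

lemma linear_hull_dim_le_1_iff:
  assumes min: "minimal_linear_representation S n u \<mu> v"
  shows "linear_hull_dim n u \<mu> \<le> 1 \<longleftrightarrow> finitely_many_quotient_lines S"
proof -
  have rep: "linear_representation S n u \<mu> v"
    using min unfolding minimal_linear_representation_def by auto
  note carrier = rep_carrier[OF rep]
  let ?s = "row_series \<mu> v"
  let ?y = "\<lambda>w. mult_vec_mat u (\<mu> w)"
  have y: "?y w \<in> carrier_vec n" for w by (rule mult_vec_mat_carrier[OF carrier(3)])
  have quot: "left_quotient w S = ?s (?y w)" for w
    using left_quotient_row_series[OF rep carrier(1)] row_series_init[OF rep] by simp
  have inj: "z = z'" if "z \<in> carrier_vec n" "z' \<in> carrier_vec n" "?s z = ?s z'" for z z'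
    using inj_on_row_series_if_minimal[OF rep min] that by (auto dest: inj_onD)
  show ?thesis
    unfolding linear_hull_dim_le_1_iff_lines[where \<mu> = \<mu>, OF carrier(3)]
  proof
    assume "\<exists>T. finite T \<and> T \<subseteq> carrier_vec n \<and> (\<forall>w. \<exists>t\<in>T. \<exists>a. ?y w = a \<cdot>\<^sub>v t)"
    then obtain T where T: "finite T" "T \<subseteq> carrier_vec n" "\<And>w. \<exists>t\<in>T. \<exists>a. ?y w = a \<cdot>\<^sub>v t" by auto
    have "\<exists>r\<in>?s ` T. \<exists>c. left_quotient w S = series_scale c r" for w
    proof -
      obtain t a where t: "t \<in> T" "?y w = a \<cdot>\<^sub>v t" using T(3) by blast
      then have "left_quotient w S = series_scale a (?s t)"
        using quot row_series_smult[OF rep] T(2) by auto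
      then show ?thesis using t(1) by blast
    qed
    then show "finitely_many_quotient_lines S"
      unfolding finitely_many_quotient_lines_def using T(1) by (intro exI[of _ "?s ` T"]) auto
  next
    assume "finitely_many_quotient_lines S"
    then obtain R where R: "finite R" "\<And>w. \<exists>r\<in>R. \<exists>c. left_quotient w S = series_scale c r"
      unfolding finitely_many_quotient_lines_def by auto
    let ?on = "\<lambda>r z. z \<in> carrier_vec n \<and> z \<noteq> 0\<^sub>v n \<and> (\<exists>c. ?s z = series_scale c r)"
    \<comment> \<open>A nonzero row vector whose series is proportional to \<open>r\<close>; by injectivity all such vectors
      are proportional. Without any, only the zero vector has to be covered.\<close>
    define t where "t r = (if \<exists>z. ?on r z then SOME z. ?on r z else 0\<^sub>v n)" for r
    have t_carrier: "t r \<in> carrier_vec n" for r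
      using someI_ex[of "?on r"] unfolding t_def by auto
    have "\<exists>z\<in>t ` R. \<exists>a. ?y w = a \<cdot>\<^sub>v z" for w
    proof -
      obtain r c where r: "r \<in> R" "left_quotient w S = series_scale c r" using R(2) by blast
      have "\<exists>a. ?y w = a \<cdot>\<^sub>v t r"
      proof (cases "?y w = 0\<^sub>v n")
        case True
        then show ?thesis using t_carrier[of r] by (intro exI[of _ 0]) auto
      next
        case False
        then have "?on r (?y w)" using y r(2) quot by metis
        then have "?on r (t r)" using someI[of "?on r" "?y w"] unfolding t_def by auto
        then obtain d where d: "t r \<noteq> 0\<^sub>v n" "?s (t r) = series_scale d r" by auto
        have s0: "?s (0\<^sub>v n) = 0"
          using rep_mult_vec_carrier[OF rep] by (simp add: row_series_def fun_eq_iff)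
        have "d \<noteq> 0"
        proof
          assume "d = 0"
          then have "?s (t r) = ?s (0\<^sub>v n)" using d(2) s0 by simp
          then show False using inj[OF t_carrier] d(1) by auto
        qed
        then have "?s ((c / d) \<cdot>\<^sub>v t r) = ?s (?y w)"
          unfolding row_series_smult[OF rep t_carrier] d(2) quot[symmetric] r(2) by simp
        then have "?y w = (c / d) \<cdot>\<^sub>v t r"
          using inj[of "(c / d) \<cdot>\<^sub>v t r" "?y w"] y t_carrier by auto
        then show ?thesis by blast
      qed
      then show ?thesis using r(1) by blast
    qed
    then show "\<exists>T. finite T \<and> T \<subseteq> carrier_vec n \<and> (\<forall>w. \<exists>t\<in>T. \<exists>a. ?y w = a \<cdot>\<^sub>v t)"
      using R(1) t_carrier by (intro exI[of _ "t ` R"]) auto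
  qed
qed

theorem theorem1p3:
  fixes S :: "('x::finite, 'k::field) series"
  assumes "rational_series S"
  shows "deterministically_recognized S \<longleftrightarrow>
    (\<forall>n u \<mu> v. minimal_linear_representation S n u \<mu> v \<longrightarrow> linear_hull_dim n u \<mu> \<le> 1)"
proof -
  obtain n u \<mu> v where "minimal_linear_representation S n u \<mu> v"
    using ex_minimal_linear_representation[OF assms] by blast
  then show ?thesis
    unfolding deterministically_recognized_iff_finitely_many_quotient_lines
    using linear_hull_dim_le_1_iff by blast
qed

end
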